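(* If $G$ is the incidence graph of a projective plane with block size $k$, then $\sigma(G) = k + 1$.
   Context: Surrounding Cops and Robbers on a finite simple graph $G$ with $k \geq 1$ cops and one robber: the cops first choose starting vertices (several cops may share a vertex), then the robber chooses a starting vertex not occupied by a cop, and thereafter the cops and the robber alternate moves, the cops moving first. In a move, each player may move to an adjacent vertex or stay put; the robber may never move to, or remain on, a vertex occupied by a cop, so if a cop moves onto the robber's vertex the robber is compelled to move to a neighbouring vertex not occupied by a cop. The cops win if at any time every neighbour of the robber's vertex is occupied by a cop; the robber wins if he avoids this forever. Play is with perfect information. The surrounding cop number $\sigma(G)$ is the least number of cops for which the cops have a winning strategy. For integers $v > k \geq 2$, $\lambda \geq 1$, a BIBD$(v,k,\lambda)$ is a pair $(X,\mathcal{B})$ with $|X| = v$ and $\mathcal{B}$ a collection of $k$-subsets (blocks) of $X$ such that every 2-subset of $X$ lies in exactly $\lambda$ blocks. A projective plane of order $q$ is a BIBD$(q^2+q+1, q+1, 1)$ (so block size $k=q+1$). The incidence graph of $(X,\mathcal{B})$ has vertex set $X \cup \mathcal{B}$, with $x \in X$ adjacent to $B \in \mathcal{B}$ iff $x \in B$.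
   Formalization: The order q of the projective plane is assumed to be at least 2 (block size k ≥ 3); for q = 1 the plane is a triangle, its incidence graph is the 6-cycle, and σ = 2 rather than k + 1 = 3. *)

theory Defs
  imports "Graph_Theory.Pair_Digraph"
begin

section \<open>Designs and incidence graphs\<close>

text \<open>
  Blocks form a set, not a multiset. For \<open>l = 1\<close>, the case of projective planes, this is no
  restriction: a block repeated twice would contain a pair covered twice.
\<close>

definition bibd :: "nat \<Rightarrow> nat \<Rightarrow> nat \<Rightarrow> 'a set \<Rightarrow> 'a set set \<Rightarrow> bool" where
  "bibd v k l X \<B> \<longleftrightarrow>
     k < v \<and> 2 \<le> k \<and> 1 \<le> l \<and>
     finite X \<and> card X = v \<and>
     (\<forall>B\<in>\<B>. B \<subseteq> X \<and> card B = k) \<and>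
     (\<forall>P. P \<subseteq> X \<and> card P = 2 \<longrightarrow> card {B \<in> \<B>. P \<subseteq> B} = l)"

definition projective_plane :: "nat \<Rightarrow> 'a set \<Rightarrow> 'a set set \<Rightarrow> bool" where
  "projective_plane q X \<B> \<longleftrightarrow> bibd (q\<^sup>2 + q + 1) (q + 1) 1 X \<B>"

definition incidence_graph :: "'a set \<Rightarrow> 'a set set \<Rightarrow> ('a + 'a set) pair_pre_digraph" where
  "incidence_graph X \<B> =
     \<lparr> pverts = Inl ` X \<union> Inr ` \<B>,
       parcs = {(Inl x, Inr B) | x B. x \<in> X \<and> B \<in> \<B> \<and> x \<in> B} \<union>
               {(Inr B, Inl x) | x B. x \<in> X \<and> B \<in> \<B> \<and> x \<in> B} \<rparr>"

lemma pair_graph_incidence_graph: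
  assumes "bibd v k l X \<B>"
  shows "pair_graph (incidence_graph X \<B>)"
proof -
  let ?G = "incidence_graph X \<B>"
  have X: "finite X" and B: "\<B> \<subseteq> Pow X"
    using assms by (auto simp: bibd_def)
  then have "finite \<B>"
    by (meson finite_Pow_iff finite_subset)
  with X have V: "finite (pverts ?G)"
    by (simp add: incidence_graph_def)
  have "parcs ?G \<subseteq> pverts ?G \<times> pverts ?G"
    by (auto simp: incidence_graph_def)
  with V have E: "finite (parcs ?G)"
    by (meson finite_SigmaI finite_subset)
  have "symmetric (with_proj ?G)"
    by (auto simp: symmetric_def sym_def incidence_graph_def)
  with V E show ?thesis
    by unfold_locales (auto simp: incidence_graph_def)
qed

section \<open>Surrounding Cops and Robbers\<close>

text \<open>
  A placement of \<open>m\<close> cops is a list of length \<open>m\<close>. A finite simple graph is a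
  \<^locale>\<open>pair_graph\<close>: its arc relation is the symmetric, irreflexive adjacency relation.
\<close>

definition step :: "'v pair_pre_digraph \<Rightarrow> 'v \<Rightarrow> 'v \<Rightarrow> bool" where
  "step G u w \<longleftrightarrow> w = u \<or> (u, w) \<in> parcs G"

definition surrounded :: "'v pair_pre_digraph \<Rightarrow> 'v list \<Rightarrow> 'v \<Rightarrow> bool" where
  "surrounded G c r \<longleftrightarrow> (\<forall>w. (r, w) \<in> parcs G \<longrightarrow> w \<in> set c)"

text \<open>
  A strategy maps the list of robber positions seen so far (oldest first) to the next placement
  of the cops; \<open>s []\<close> is the initial placement. The cops' own past positions are determined by
  \<open>s\<close> and this list. Asking for legal moves after every list of vertices, including those that
  no play produces, is harmless since cops may always stay put.
\<close>

definition cop_strategy :: "'v pair_pre_digraph \<Rightarrow> nat \<Rightarrow> ('v list \<Rightarrow> 'v list) \<Rightarrow> bool" where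
  "cop_strategy G m s \<longleftrightarrow>
     length (s []) = m \<and> set (s []) \<subseteq> pverts G \<and>
     (\<forall>h r. set h \<subseteq> pverts G \<and> r \<in> pverts G \<longrightarrow> list_all2 (step G) (s h) (s (h @ [r])))"

text \<open>
  The placement of the cops after their \<open>n\<close>-th move when the robber visits \<open>r 0, r 1, \<dots>\<close>.
\<close>

definition cops_at :: "('v list \<Rightarrow> 'v list) \<Rightarrow> (nat \<Rightarrow> 'v) \<Rightarrow> nat \<Rightarrow> 'v list" where
  "cops_at s r n = s (map r [0..<n])"

definition robber_play ::
    "'v pair_pre_digraph \<Rightarrow> ('v list \<Rightarrow> 'v list) \<Rightarrow> (nat \<Rightarrow> 'v) \<Rightarrow> bool" where
  "robber_play G s r \<longleftrightarrow>
     r 0 \<in> pverts G \<and> r 0 \<notin> set (cops_at s r 0) \<and>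
     (\<forall>n. step G (r n) (r (Suc n)) \<and> r (Suc n) \<notin> set (cops_at s r (Suc n)))"

text \<open>
  Only infinite plays need to be considered: a robber without a legal move has a cop on his
  vertex and on every neighbour, so he is surrounded. The two disjuncts are the situations after
  the robber's and after the cops' move.
\<close>

definition winning_cop_strategy ::
    "'v pair_pre_digraph \<Rightarrow> nat \<Rightarrow> ('v list \<Rightarrow> 'v list) \<Rightarrow> bool" where
  "winning_cop_strategy G m s \<longleftrightarrow>
     cop_strategy G m s \<and>
     (\<forall>r. robber_play G s r \<longrightarrow>
        (\<exists>n. surrounded G (cops_at s r n) (r n) \<or> surrounded G (cops_at s r (Suc n)) (r n)))"

definition surrounding_cop_number :: "'v pair_pre_digraph \<Rightarrow> nat" where
  "surrounding_cop_number G = (LEAST m. 1 \<le> m \<and> (\<exists>s. winning_cop_strategy G m s))"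

end

theory Submission
  imports Defs
begin

text \<open>
  In the incidence graph of a projective plane any two distinct vertices on the same side have
  exactly one common neighbour, and every vertex has degree \<open>k = q + 1\<close>.

  Upper bound: fix a line \<open>M\<close>, put one cop on each point of \<open>M\<close> and an extra cop on \<open>M\<close> itself.
  As soon as the robber is on a point \<open>p\<close> off \<open>M\<close>, the cops on the points \<open>x\<close> of \<open>M\<close> move to the
  lines \<open>px\<close> and surround him. So he has to stay forever on the line he started on, until the
  extra cop steps onto it and expels him to a point off \<open>M\<close>.

  Lower bound: the robber keeps a neighbour \<open>w\<close> of his position such that no cop is on \<open>w\<close> or
  adjacent to \<open>w\<close>; then he is not surrounded now, nor after the next move of the cops. If a move
  to a free neighbour \<open>L\<close> of his position \<open>p\<close> does not preserve this, then each of the at most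
  \<open>k\<close> cops guards exactly one of the \<open>k\<close> neighbours of \<open>L\<close>, and in particular exactly one cop
  guards \<open>p\<close>. If this cop is not on \<open>p\<close>, the robber can stay on \<open>p\<close>. If it is, two other cops
  have a common neighbour \<open>z\<close>, and the robber can move to the vertex joining \<open>z\<close> to \<open>p\<close>.
\<close>

section \<open>Graphs in which vertices on the same side have a unique common neighbour\<close>

text \<open>Points and blocks enter symmetrically, so one argument covers a robber on either kind of
  vertex; \<open>side\<close> only records the bipartition.\<close>

locale unique_join_graph =
  fixes G :: "'v pair_pre_digraph" and side :: "'v \<Rightarrow> bool" and k :: nat
  assumes arc_tail: "(u, w) \<in> parcs G \<Longrightarrow> u \<in> pverts G"
    and arc_sym: "(u, w) \<in> parcs G \<Longrightarrow> (w, u) \<in> parcs G"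
    and arc_side: "(u, w) \<in> parcs G \<Longrightarrow> side u \<noteq> side w"
    and degree: "u \<in> pverts G \<Longrightarrow> card {w. (u, w) \<in> parcs G} = k"
    and join_exists: "\<lbrakk>u \<in> pverts G; v \<in> pverts G; u \<noteq> v; side u = side v\<rbrakk>
      \<Longrightarrow> \<exists>w. (u, w) \<in> parcs G \<and> (v, w) \<in> parcs G"
    and join_unique: "\<lbrakk>u \<noteq> v; (u, w) \<in> parcs G; (v, w) \<in> parcs G;
      (u, w') \<in> parcs G; (v, w') \<in> parcs G\<rbrakk> \<Longrightarrow> w = w'"
    and degree_ge: "3 \<le> k"
    and verts_nonempty: "pverts G \<noteq> {}"
begin

abbreviation nbrs :: "'v \<Rightarrow> 'v set" where
  "nbrs u \<equiv> {w. (u, w) \<in> parcs G}"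

abbreviation closed_nbrs :: "'v \<Rightarrow> 'v set" where
  "closed_nbrs u \<equiv> insert u (nbrs u)"

lemma arc_head: "(u, w) \<in> parcs G \<Longrightarrow> w \<in> pverts G"
  using arc_sym arc_tail by blast

lemma finite_nbrs: "u \<in> pverts G \<Longrightarrow> finite (nbrs u)"
  using degree degree_ge by (metis card.infinite not_numeral_le_zero)

subsection \<open>Evading \<open>k\<close> cops\<close>

definition safe :: "'v set \<Rightarrow> 'v \<Rightarrow> bool" where
  "safe C r \<longleftrightarrow> (\<exists>w \<in> nbrs r. closed_nbrs w \<inter> C = {})"

text \<open>As \<open>x\<close> and \<open>y\<close> lie on one side they are not adjacent, so for
  \<open>x \<noteq> y\<close> the cop \<open>c\<close> would be a second common neighbour besides
  \<open>L\<close>.\<close>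

lemma guards_disjoint:
  assumes "x \<in> nbrs L" "y \<in> nbrs L" "c \<in> closed_nbrs x" "c \<in> closed_nbrs y" "c \<noteq> L"
  shows "x = y"
proof -
  have "(x, y) \<notin> parcs G" "(y, x) \<notin> parcs G"
    using assms(1,2) arc_side by blast+
  then consider "x = y" | "(x, c) \<in> parcs G" "(y, c) \<in> parcs G"
    using assms(3,4) by auto
  then show ?thesis
    using assms(1,2,5) arc_sym join_unique[of L c x y] by cases auto
qed

text \<open>Around an unsafe free \<open>L\<close>, the \<open>k\<close> sets
  \<open>closed_nbrs x \<inter> C\<close> are nonempty, and disjoint by
  \<open>guards_disjoint\<close>. Since \<open>C\<close> has at most \<open>k\<close> elements,
  equality holds throughout.\<close>

lemma unsafe_guards:
  assumes "finite C" "card C \<le> k" "L \<in> pverts G" "L \<notin> C" "\<not> safe C L"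
  shows "\<forall>x \<in> nbrs L. card (closed_nbrs x \<inter> C) = 1"
    and "C \<subseteq> (\<Union>x \<in> nbrs L. closed_nbrs x)"
    and "card C = k"
proof -
  let ?A = "\<lambda>x. closed_nbrs x \<inter> C"
  have fin: "finite (nbrs L)"
    by (rule finite_nbrs) fact
  have "card (\<Union>x \<in> nbrs L. ?A x) = (\<Sum>x \<in> nbrs L. card (?A x))"
  proof (rule card_UN_disjoint)
    show "\<forall>x \<in> nbrs L. \<forall>y \<in> nbrs L. x \<noteq> y \<longrightarrow> ?A x \<inter> ?A y = {}"
      using guards_disjoint assms(4) by blast
  qed (use fin assms(1) in auto)
  moreover have sub: "(\<Union>x \<in> nbrs L. ?A x) \<subseteq> C" by blast
  then have "card (\<Union>x \<in> nbrs L. ?A x) \<le> card C"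
    using assms(1) by (rule card_mono[rotated])
  moreover have ge: "1 \<le> card (?A x)" if "x \<in> nbrs L" for x
    using that assms(1,5) by (auto simp: safe_def Suc_le_eq card_gt_0_iff)
  have "(\<Sum>x \<in> nbrs L. 1) \<le> (\<Sum>x \<in> nbrs L. card (?A x))"
    by (rule sum_mono) (use ge in blast)
  moreover have k: "(\<Sum>x \<in> nbrs L. 1) = k"
    using degree[OF assms(3)] by simp
  ultimately have eqs: "card C = k" "(\<Sum>x \<in> nbrs L. card (?A x)) = (\<Sum>x \<in> nbrs L. 1)"
      "card (\<Union>x \<in> nbrs L. ?A x) = card C"
    using assms(2) by linarith+
  show "card C = k" by fact
  show "\<forall>x \<in> nbrs L. card (?A x) = 1"
  proof (rule ccontr)
    assume "\<not> (\<forall>x \<in> nbrs L. card (?A x) = 1)"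
    then obtain x where x: "x \<in> nbrs L" "card (?A x) \<noteq> 1" by blast
    then have "1 < card (?A x)" using ge[of x] by linarith
    then have "(\<Sum>x \<in> nbrs L. 1) < (\<Sum>x \<in> nbrs L. card (?A x))"
      using x(1) fin ge by (intro sum_strict_mono_ex1) blast+
    then show False using eqs(2) by simp
  qed
  have "(\<Union>x \<in> nbrs L. ?A x) = C"
    using card_subset_eq[OF assms(1) sub eqs(3)] .
  then show "C \<subseteq> (\<Union>x \<in> nbrs L. closed_nbrs x)" by blast
qed

text \<open>\<open>C\<close> is the placement just after a cop move, so \<open>p\<close> itself may
  be occupied; the free neighbour \<open>L0\<close> says that the robber is not surrounded.\<close>

lemma robber_escape:
  assumes C: "finite C" "card C \<le> k" and p: "p \<in> pverts G" and L0: "L0 \<in> nbrs p" "L0 \<notin> C"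
  shows "\<exists>r. step G p r \<and> r \<notin> C \<and> safe C r"
proof (rule ccontr)
  assume no: "\<not> ?thesis"
  have unsafe: "L \<in> pverts G" "\<not> safe C L" "p \<in> nbrs L" if "L \<in> nbrs p" "L \<notin> C" for L
    using no that arc_head arc_sym by (auto simp: step_def)
  note guards = unsafe_guards[OF C unsafe(1) _ unsafe(2)]
  from guards(1)[OF L0 L0(2) L0] unsafe(3)[OF L0]
  have "card (closed_nbrs p \<inter> C) = 1" by blast
  then obtain c where c: "closed_nbrs p \<inter> C = {c}"
    by (auto simp: card_1_singleton_iff)
  show False
  proof (cases "c = p")
    case False
    have "p \<notin> C"
    proof
      assume "p \<in> C"
      then have "p \<in> closed_nbrs p \<inter> C" by simp
      then show False using c False by simp
    qed
    \<comment> \<open>Degree at least 3 leaves a neighbour \<open>L1\<close> other than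
      \<open>c\<close> and \<open>L0\<close>; it is free because \<open>c\<close> is the only cop
      near \<open>p\<close>.\<close>
    have "\<not> nbrs p \<subseteq> {c, L0}"
      using card_mono[of "{c, L0}" "nbrs p"] degree[OF p] degree_ge card_insert_le_m1[of 2 "{L0}" c]
      by auto
    then obtain L1 where L1: "L1 \<in> nbrs p" "L1 \<noteq> L0" "L1 \<notin> C"
      using c by blast
    \<comment> \<open>A cop \<open>d\<close> next to \<open>L0\<close> must also guard a neighbour
      of \<open>L1\<close>. Sides force \<open>d\<close> to be that neighbour, so \<open>d\<close>
      and \<open>p\<close> would both join \<open>L0\<close> and \<open>L1\<close>.\<close>
    have "closed_nbrs L0 \<inter> C = {}"
    proof (rule ccontr)
      assume "closed_nbrs L0 \<inter> C \<noteq> {}"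
      then obtain d where d: "d \<in> nbrs L0" "d \<in> C" using L0 by auto
      have "d \<noteq> p" using \<open>p \<notin> C\<close> d(2) by blast
      obtain x where x: "x \<in> nbrs L1" "d \<in> closed_nbrs x"
        using guards(2)[OF L1(1) L1(3) L1(3) L1(1) L1(3)] d(2) by blast
      have "side d = side p" "side x = side p"
        using arc_side d(1) L0(1) x(1) L1(1) by blast+
      then have "d = x" using x(2) arc_side by auto
      then show False
        using join_unique[of L0 L1 d p] d(1) x(1) L1(2) unsafe(3)[OF L0] unsafe(3)[OF L1(1,3)]
          \<open>d \<noteq> p\<close> by simp
    qed
    then have "safe C p" using L0(1) by (auto simp: safe_def)
    then show False using no \<open>p \<notin> C\<close> by (auto simp: step_def)
  next
    case True
    \<comment> \<open>The cop on \<open>p\<close> is the only one near \<open>p\<close>, so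
      \<open>unsafe_guards\<close> becomes available at every neighbour of \<open>p\<close>.\<close>
    have free: "M \<notin> C" if "M \<in> nbrs p" for M
    proof
      assume "M \<in> C"
      then have "M \<in> closed_nbrs p \<inter> C" using that by simp
      then show False using c True that arc_side by auto
    qed
    have "card C = k" using guards(3)[OF L0 L0(2) L0] .
    then have "2 \<le> card (C - {p})"
      using degree_ge by (auto simp: card_Diff_singleton_if)
    then obtain a b where ab: "a \<in> C - {p}" "b \<in> C - {p}" "a \<noteq> b"
      by (meson card_2_iff' obtain_subset_with_card_n subsetD)
    \<comment> \<open>A cop other than \<open>p\<close> on its side would be adjacent to every neighbour of \<open>p\<close>.\<close>
    have cops: "d \<in> pverts G" "side d \<noteq> side p" "(d, p) \<notin> parcs G" if d: "d \<in> C - {p}" for d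
    proof -
      show "(d, p) \<notin> parcs G" using free[of d] d arc_sym by blast
      have on: "\<exists>x \<in> nbrs L. d \<in> closed_nbrs x" if "L \<in> nbrs p" for L
        using guards(2)[OF that free[OF that] free[OF that] that free[OF that]] d by blast
      from on[OF L0(1)] obtain x where "x \<in> nbrs L0" "d \<in> closed_nbrs x" by blast
      then show "d \<in> pverts G" using arc_head by auto
      have "\<not> nbrs p \<subseteq> {L0}"
        using card_mono[of "{L0}" "nbrs p"] degree[OF p] degree_ge by auto
      then obtain L1 where L1: "L1 \<in> nbrs p" "L1 \<noteq> L0" by blast
      show "side d \<noteq> side p"
      proof
        assume s: "side d = side p"
        have "d \<in> nbrs L" if L: "L \<in> nbrs p" for L
        proof -
          obtain x where x: "x \<in> nbrs L" "d \<in> closed_nbrs x" using on[OF L] by blast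
          then have "side x = side d" using s arc_side L by blast
          then show ?thesis using x arc_side by auto
        qed
        then show False
          using join_unique[of L0 L1 d p] L0(1) L1 d arc_sym by blast
      qed
    qed
    then obtain z where z: "(a, z) \<in> parcs G" "(b, z) \<in> parcs G"
      using join_exists[of a b] ab by metis
    have "z \<noteq> p" "side z = side p" "z \<in> pverts G"
      using z cops ab(1) arc_side arc_head by metis+
    then obtain M where M: "(z, M) \<in> parcs G" "(p, M) \<in> parcs G"
      using join_exists[of z p] p by blast
    then have Mp: "M \<in> nbrs p" by simp
    \<comment> \<open>\<open>M\<close> is free and unsafe, so only one cop may guard its neighbour
      \<open>z\<close>, whereas both \<open>a\<close> and \<open>b\<close> do.\<close>
    have "card (closed_nbrs z \<inter> C) = 1"
      using guards(1)[OF Mp free[OF Mp] free[OF Mp] Mp free[OF Mp]] M arc_sym by blast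
    moreover have "{a, b} \<subseteq> closed_nbrs z \<inter> C" using z ab arc_sym by blast
    then have "card {a, b} \<le> card (closed_nbrs z \<inter> C)"
      using C(1) by (intro card_mono) auto
    ultimately show False using ab(3) by simp
  qed
qed

text \<open>Apply \<open>robber_escape\<close> to a fictitious robber beside a free vertex. One
  exists because a closed neighbourhood has \<open>k + 1\<close> vertices.\<close>

lemma safe_start:
  assumes C: "finite C" "card C \<le> k"
  shows "\<exists>r \<in> pverts G. r \<notin> C \<and> safe C r"
proof -
  have esc: "\<exists>r \<in> pverts G. r \<notin> C \<and> safe C r"
    if p: "p \<in> pverts G" "L \<in> nbrs p" "L \<notin> C" for p L
    using robber_escape[OF C p] p(1) arc_head by (auto simp: step_def)
  obtain p where p: "p \<in> pverts G" using verts_nonempty by blast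
  have "p \<notin> nbrs p" using arc_side by blast
  then have "card (closed_nbrs p) = Suc k"
    using degree[OF p] finite_nbrs[OF p] by simp
  then have "\<not> closed_nbrs p \<subseteq> C"
    using card_mono[OF C(1), of "closed_nbrs p"] C(2) by linarith
  then consider L where "L \<in> nbrs p" "L \<notin> C" | "p \<notin> C" by blast
  then show ?thesis
  proof cases
    case 1
    then show ?thesis using esc p by blast
  next
    case 2
    obtain L where "L \<in> nbrs p"
      using degree[OF p] degree_ge by (metis card.empty equals0I not_numeral_le_zero)
    \<comment> \<open>The roles swap: the fictitious robber stands on \<open>L\<close>, with
      \<open>p\<close> as its free neighbour.\<close>
    then show ?thesis using esc[of L p] 2 arc_head arc_sym by blast
  qed
qed

section \<open>From single moves to infinite plays of the robber\<close>

lemma cop_strategy_length: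
  assumes "cop_strategy G m s" "set h \<subseteq> pverts G"
  shows "length (s h) = m"
  using assms(2)
proof (induction h rule: rev_induct)
  case Nil
  then show ?case using assms(1) by (simp add: cop_strategy_def)
next
  case (snoc r h)
  then have "list_all2 (step G) (s h) (s (h @ [r]))"
    using assms(1) by (simp add: cop_strategy_def)
  then show ?case using snoc list_all2_lengthD by fastforce
qed

text \<open>A cop can reach the witness \<open>w\<close> of safety in one step only from
  \<open>closed_nbrs w\<close>, which contains no cop.\<close>

lemma safe_after_cops_move:
  assumes "list_all2 (step G) c c'" "safe (set c) r"
  shows "\<exists>w \<in> nbrs r. w \<notin> set c \<and> w \<notin> set c'"
proof -
  obtain w where w: "w \<in> nbrs r" "closed_nbrs w \<inter> set c = {}"
    using assms(2) by (auto simp: safe_def)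
  have "w \<notin> set c'"
  proof
    assume "w \<in> set c'"
    then obtain u where "u \<in> set c" "step G u w"
      using assms(1) by (metis in_set_conv_nth list_all2_conv_all_nth)
    then show False using w(2) arc_sym by (auto simp: step_def)
  qed
  then show ?thesis using w by blast
qed

lemma no_winning_strategy:
  assumes "m \<le> k"
  shows "\<not> winning_cop_strategy G m s"
proof
  assume win: "winning_cop_strategy G m s"
  then have s: "cop_strategy G m s" by (simp add: winning_cop_strategy_def)
  have card: "card (set (s h)) \<le> k" if "set h \<subseteq> pverts G" for h
    using cop_strategy_length[OF s that] card_length[of "s h"] assms by simp
  obtain r0 where r0: "r0 \<in> pverts G" "r0 \<notin> set (s [])" "safe (set (s [])) r0"
    using safe_start[OF finite_set card[of "[]"]] by auto
  \<comment> \<open>A state pairs the robber's earlier positions with his current one, which is not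
    yet in the history; thus \<open>s (fst g)\<close> is the placement he faces before the next cop
    move. Dependent choice then yields the play.\<close>
  define inv where "inv g \<longleftrightarrow>
    set (fst g) \<subseteq> pverts G \<and> snd g \<in> pverts G \<and> safe (set (s (fst g))) (snd g)" for g
  define succ where "succ g g' \<longleftrightarrow> fst g' = fst g @ [snd g] \<and> step G (snd g) (snd g') \<and>
    snd g' \<notin> set (s (fst g'))" for g g' :: "'v list \<times> 'v"
  have nxt: "\<exists>g'. inv g' \<and> succ g g'" if g: "inv g" for g
  proof -
    let ?h = "fst g @ [snd g]"
    have h: "set ?h \<subseteq> pverts G" using g by (simp add: inv_def)
    have "list_all2 (step G) (s (fst g)) (s ?h)"
      using s g by (simp add: cop_strategy_def inv_def)
    then obtain w where "w \<in> nbrs (snd g)" "w \<notin> set (s ?h)"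
      using safe_after_cops_move g unfolding inv_def by blast
    then obtain r where r: "step G (snd g) r" "r \<notin> set (s ?h)" "safe (set (s ?h)) r"
      using robber_escape[OF finite_set card[OF h], of "snd g" w] h by auto
    have "r \<in> pverts G" using r(1) h arc_head by (auto simp: step_def)
    then have "inv (?h, r) \<and> succ g (?h, r)" using r h by (simp add: inv_def succ_def)
    then show ?thesis by blast
  qed
  have "inv ([], r0)" using r0 by (simp add: inv_def)
  then have "\<exists>f. \<forall>n. (inv (f n) \<and> (n = 0 \<longrightarrow> f n = ([], r0))) \<and> succ (f n) (f (Suc n))"
    using nxt by (intro dependent_nat_choice) auto
  then obtain f where f: "f 0 = ([], r0)" "\<And>n. inv (f n)" "\<And>n. succ (f n) (f (Suc n))"
    by blast
  define r where "r n = snd (f n)" for n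
  have hist: "fst (f n) = map r [0..<n]" for n
    by (induction n) (use f(1,3) in \<open>auto simp: succ_def r_def\<close>)
  have cops: "cops_at s r n = s (fst (f n))" for n
    by (simp add: cops_at_def hist)
  have "robber_play G s r"
    using f(1,3) r0 unfolding robber_play_def cops r_def succ_def
    by (metis fst_conv snd_conv)
  then obtain n where n: "surrounded G (cops_at s r n) (r n) \<or> surrounded G (cops_at s r (Suc n)) (r n)"
    using win by (auto simp: winning_cop_strategy_def)
  have "list_all2 (step G) (cops_at s r n) (cops_at s r (Suc n))"
    using s f(2)[of n] f(3)[of n] by (simp add: cops cop_strategy_def inv_def succ_def)
  moreover have "safe (set (cops_at s r n)) (r n)"
    using f(2)[of n] by (simp add: inv_def cops r_def)
  ultimately show False
    using safe_after_cops_move n unfolding surrounded_def by blast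
qed

subsection \<open>Surrounding the robber with \<open>k + 1\<close> cops\<close>

text \<open>Each cop \<open>x\<close> moves to the join \<open>f x\<close> of \<open>x\<close> and
  \<open>r\<close>. This fills \<open>nbrs r\<close>: a neighbour \<open>w\<close> of
  \<open>r\<close> differs from \<open>M\<close>, so it has a common neighbour \<open>x\<close> with
  \<open>M\<close>, and \<open>w = f x\<close> by uniqueness.\<close>

lemma surround_from_nbrs:
  assumes M: "M \<in> pverts G" and xs: "set xs = nbrs M"
    and r: "r \<in> pverts G" "side r \<noteq> side M" "r \<notin> nbrs M"
  shows "\<exists>ys. list_all2 (step G) xs ys \<and> surrounded G ys r"
proof -
  have "\<exists>w. (x, w) \<in> parcs G \<and> (r, w) \<in> parcs G" if "x \<in> nbrs M" for x
    using that r arc_side[of M x] arc_head by (intro join_exists) auto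
  then obtain f where f: "\<And>x. x \<in> nbrs M \<Longrightarrow> (x, f x) \<in> parcs G \<and> (r, f x) \<in> parcs G"
    by metis
  have "list_all2 (step G) xs (map f xs)"
    using f xs nth_mem by (fastforce simp: list_all2_conv_all_nth step_def)
  moreover have "w \<in> f ` nbrs M" if w: "(r, w) \<in> parcs G" for w
  proof -
    have "w \<noteq> M" using w r(3) arc_sym by blast
    then obtain x where x: "(w, x) \<in> parcs G" "(M, x) \<in> parcs G"
      using join_exists[of w M] M w r(2) arc_head arc_side by metis
    have "x \<noteq> r" using x r(3) by blast
    then have "w = f x"
      using join_unique[of x r w "f x"] f[of x] x w arc_sym by blast
    then show ?thesis using x by blast
  qed
  then have "surrounded G (map f xs) r" by (auto simp: surrounded_def xs)
  ultimately show ?thesis by blast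
qed

text \<open>The head of the list is the extra cop, who moves towards the robber.\<close>

definition chase :: "'v list \<Rightarrow> 'v \<Rightarrow> 'v list" where
  "chase c r =
     (if \<exists>c'. list_all2 (step G) c c' \<and> surrounded G c' r
      then SOME c'. list_all2 (step G) c c' \<and> surrounded G c' r
      else if c = [] then c
      else if (hd c, r) \<in> parcs G then r # tl c
      else if \<exists>z. (hd c, z) \<in> parcs G \<and> (z, r) \<in> parcs G
      then (SOME z. (hd c, z) \<in> parcs G \<and> (z, r) \<in> parcs G) # tl c
      else c)"

text \<open>Legality for arbitrary \<open>c\<close> and \<open>r\<close> covers every history
  quantified over in \<open>cop_strategy\<close>; the branches of \<open>chase\<close> returning
  \<open>c\<close> serve as defaults.\<close>

lemma step_chase: "list_all2 (step G) c (chase c r)"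
proof -
  have refl: "list_all2 (step G) d d" for d
    by (simp add: list_all2_conv_all_nth step_def)
  have hd: "list_all2 (step G) c (z # tl c)" if "c \<noteq> []" "(hd c, z) \<in> parcs G" for z
    using that refl by (cases c) (auto simp: step_def)
  show ?thesis
    unfolding chase_def
    by (smt (verit, best) refl hd someI_ex)
qed

lemma surrounded_chase:
  assumes "list_all2 (step G) c c'" "surrounded G c' r"
  shows "surrounded G (chase c r) r"
proof -
  have ex: "\<exists>c'. list_all2 (step G) c c' \<and> surrounded G c' r" using assms by blast
  from someI_ex[OF this] show ?thesis unfolding chase_def if_P[OF ex] by (rule conjunct2)
qed

lemma winning_strategy: "\<exists>s. winning_cop_strategy G (Suc k) s"
proof -
  obtain M where M: "M \<in> pverts G" using verts_nonempty by blast
  obtain xs where xs: "set xs = nbrs M" "distinct xs"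
    using finite_distinct_list[OF finite_nbrs[OF M]] by blast
  then have len: "length xs = k" using degree[OF M] distinct_card by metis
  \<comment> \<open>The strategy uses only the previous placement and the latest robber position;
    \<open>foldl\<close> replays the history.\<close>
  define s where "s = foldl chase (M # xs)"
  have "cop_strategy G (Suc k) s"
    using len M xs arc_head by (auto simp: cop_strategy_def s_def step_chase)
  moreover have "\<exists>n. surrounded G (cops_at s r n) (r n) \<or> surrounded G (cops_at s r (Suc n)) (r n)"
    if play: "robber_play G s r" for r
  proof (rule ccontr)
    assume "\<not> ?thesis"
    then have no: "\<not> surrounded G (cops_at s r (Suc n)) (r n)" for n by blast
    have C0: "cops_at s r 0 = M # xs" by (simp add: cops_at_def s_def)
    have CS: "cops_at s r (Suc n) = chase (cops_at s r n) (r n)" for n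
      by (simp add: cops_at_def s_def)
    have nosur: "\<not> (\<exists>c'. list_all2 (step G) (cops_at s r n) c' \<and> surrounded G c' (r n))" for n
      using no surrounded_chase CS by metis
    \<comment> \<open>The surrounding branch never fires, and the other branches change at most the
      head.\<close>
    have tl: "\<exists>e. cops_at s r n = e # xs" for n
    proof (induction n)
      case (Suc n)
      then show ?case using nosur[of n] by (auto simp: CS chase_def)
    qed (simp add: C0)
    have moves: "step G (r n) (r (Suc n))" "r n \<notin> set (cops_at s r n)" for n
      using play by (cases n; auto simp: robber_play_def)+
    have V: "r n \<in> pverts G" for n
    proof (induction n)
      case (Suc n)
      then show ?case using moves(1)[of n] arc_head by (auto simp: step_def)
    qed (use play in \<open>simp add: robber_play_def\<close>)
    \<comment> \<open>On the other side he would be surrounded by the cops of \<open>xs\<close>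
      while the extra cop stays put. Since arcs switch sides, he can then never move.\<close>
    have sd: "side (r n) = side M" for n
    proof (rule ccontr)
      assume "side (r n) \<noteq> side M"
      moreover obtain e where e: "cops_at s r n = e # xs" using tl by blast
      moreover have "r n \<notin> nbrs M" using moves(2)[of n] e xs(1) by auto
      ultimately obtain ys where "list_all2 (step G) xs ys" "surrounded G ys (r n)"
        using surround_from_nbrs[OF M xs(1) V] by blast
      then have "list_all2 (step G) (e # xs) (e # ys) \<and> surrounded G (e # ys) (r n)"
        by (auto simp: step_def surrounded_def)
      then show False using nosur[of n] e by metis
    qed
    have const: "r (Suc n) = r n" for n
      using moves(1)[of n] sd arc_side by (metis step_def)
    \<comment> \<open>\<open>M\<close> and \<open>r 0\<close> are at distance two, so the extra cop
      needs exactly two moves to step onto the motionless robber.\<close>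
    have "r 0 \<noteq> M" using moves(2)[of 0] C0 by simp
    then obtain z where "(M, z) \<in> parcs G" "(z, r 0) \<in> parcs G"
      using join_exists[OF M V] sd arc_sym by metis
    then have ex: "\<exists>z. (M, z) \<in> parcs G \<and> (z, r 0) \<in> parcs G" by blast
    have "(M, r 0) \<notin> parcs G" using sd arc_side by metis
    then have "cops_at s r 1 = (SOME z. (M, z) \<in> parcs G \<and> (z, r 0) \<in> parcs G) # xs"
      using ex CS[of 0] unfolding C0 chase_def if_not_P[OF nosur[of 0, unfolded C0]] by simp
    then obtain z where z: "cops_at s r 1 = z # xs" "(z, r 0) \<in> parcs G"
      using someI_ex[OF ex] by blast
    then have "cops_at s r 2 = r 0 # xs"
      using CS[of 1] const[of 0] unfolding chase_def if_not_P[OF nosur[of 1]]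
      by (simp add: numeral_2_eq_2)
    then show False
      using moves(2)[of 2] const[of 0] const[of 1] by (simp add: numeral_2_eq_2)
  qed
  ultimately show ?thesis by (auto simp: winning_cop_strategy_def)
qed

theorem surrounding_cop_number_eq: "surrounding_cop_number G = k + 1"
  unfolding surrounding_cop_number_def
proof (rule Least_equality)
  show "1 \<le> k + 1 \<and> (\<exists>s. winning_cop_strategy G (k + 1) s)"
    using winning_strategy by simp
  show "k + 1 \<le> m" if "1 \<le> m \<and> (\<exists>s. winning_cop_strategy G m s)" for m
    using that no_winning_strategy[of m] by (cases "m \<le> k") auto
qed

end

section \<open>Projective planes\<close>

context
  fixes X :: "'a set" and \<B> :: "'a set set" and q :: nat
  assumes plane: "projective_plane q X \<B>"
begin

section \<open>Counting points and blocks\<close>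

lemma plane_points: "finite X" "card X = q\<^sup>2 + q + 1" "1 \<le> q"
  using plane by (auto simp: projective_plane_def bibd_def)

lemma plane_block:
  assumes "B \<in> \<B>"
  shows "B \<subseteq> X" "card B = q + 1" "finite B"
  using plane assms finite_subset by (auto simp: projective_plane_def bibd_def)

lemma finite_plane_blocks: "finite \<B>"
  using plane_block(1) plane_points(1) by (meson Pow_iff finite_Pow_iff finite_subset subsetI)

lemma plane_join:
  assumes "x \<in> X" "y \<in> X" "x \<noteq> y"
  shows "\<exists>!B. B \<in> \<B> \<and> x \<in> B \<and> y \<in> B"
proof -
  have "{x, y} \<subseteq> X \<and> card {x, y} = 2" using assms by simp
  then have "card {B \<in> \<B>. {x, y} \<subseteq> B} = 1"
    using plane unfolding projective_plane_def bibd_def by blast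
  then obtain B where "{B \<in> \<B>. {x, y} \<subseteq> B} = {B}"
    by (auto simp: card_1_singleton_iff)
  then show ?thesis by (intro ex1I[of _ B]) auto
qed

text \<open>The blocks through \<open>x\<close>, with \<open>x\<close> removed, partition the
  \<open>(q + 1) * q\<close> other points into sets of size \<open>q\<close>.\<close>

lemma plane_degree:
  assumes x: "x \<in> X"
  shows "card {B \<in> \<B>. x \<in> B} = q + 1"
proof -
  let ?L = "{B \<in> \<B>. x \<in> B}"
  have "\<exists>B \<in> ?L. y \<in> B - {x}" if "y \<in> X - {x}" for y
    using plane_join[OF x, of y] that by auto
  then have "X - {x} = (\<Union>B \<in> ?L. B - {x})"
    using plane_block(1) by fast
  moreover have "card (\<Union>B \<in> ?L. B - {x}) = (\<Sum>B \<in> ?L. card (B - {x}))"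
  proof (rule card_UN_disjoint)
    have "A = B" if "A \<in> ?L" "B \<in> ?L" "y \<in> (A - {x}) \<inter> (B - {x})" for A B y
      using plane_join[OF x, of y] plane_block(1)[of A] that by auto
    then show "\<forall>A \<in> ?L. \<forall>B \<in> ?L. A \<noteq> B \<longrightarrow> (A - {x}) \<inter> (B - {x}) = {}"
      by blast
  qed (use finite_plane_blocks plane_block(3) in auto)
  moreover have "(\<Sum>B \<in> ?L. card (B - {x})) = (\<Sum>B \<in> ?L. q)"
    by (rule sum.cong) (auto simp: plane_block)
  ultimately have "card ?L * q = card (X - {x})" by simp
  also have "\<dots> = (q + 1) * q"
    using x plane_points by (simp add: power2_eq_square)
  finally show ?thesis using plane_points(3) by (metis mult_right_cancel not_one_le_zero)
qed

text \<open>Take \<open>a\<close> in \<open>A\<close> off \<open>B\<close>. Joining \<open>a\<close>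
  to the \<open>q + 1\<close> points of \<open>B\<close> gives distinct blocks, since a repeated one
  would be \<open>B\<close>. These are all the blocks through \<open>a\<close>, so \<open>A\<close>
  is among them.\<close>

lemma plane_meet:
  assumes A: "A \<in> \<B>" and B: "B \<in> \<B>" and "A \<noteq> B"
  shows "A \<inter> B \<noteq> {}"
proof -
  have "\<not> A \<subseteq> B"
    using assms plane_block card_subset_eq by metis
  then obtain a where a: "a \<in> A" "a \<notin> B" by blast
  then have aX: "a \<in> X" using A plane_block(1) by blast
  let ?L = "{B \<in> \<B>. a \<in> B}"
  have ex: "\<exists>J. J \<in> ?L \<and> b \<in> J" if "b \<in> B" for b
    using plane_join[OF aX, of b] that a(2) B plane_block(1) by blast
  then obtain J where J: "\<And>b. b \<in> B \<Longrightarrow> J b \<in> ?L \<and> b \<in> J b" by metis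
  have "inj_on J B"
  proof (rule inj_onI, rule ccontr)
    fix b c assume bc: "b \<in> B" "c \<in> B" "J b = J c" "b \<noteq> c"
    then have "J b = B"
      using plane_join[of b c] J[of b] J[of c] B plane_block(1)[OF B] by auto
    then show False using J[of b] bc(1) a(2) by auto
  qed
  then have "card (J ` B) = card ?L"
    using plane_degree[OF aX] plane_block(2)[OF B] by (simp add: card_image)
  moreover have "J ` B \<subseteq> ?L" using J by blast
  ultimately have "J ` B = ?L"
    using finite_plane_blocks by (intro card_subset_eq) auto
  then obtain b where "b \<in> B" "A = J b" using A a(1) by blast
  then show ?thesis using J by blast
qed

lemma unique_join_incidence_graph:
  assumes "2 \<le> q"
  shows "unique_join_graph (incidence_graph X \<B>) isl (q + 1)"
proof
  let ?G = "incidence_graph X \<B>"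
  note G = incidence_graph_def
  fix u v w w' :: "'a + 'a set"
  show "u \<in> pverts ?G" if "(u, w) \<in> parcs ?G"
    using that by (auto simp: G)
  show "(w, u) \<in> parcs ?G" if "(u, w) \<in> parcs ?G"
    using that by (auto simp: G)
  show "isl u \<noteq> isl w" if "(u, w) \<in> parcs ?G"
    using that by (auto simp: G)
  show "card {w. (u, w) \<in> parcs ?G} = q + 1" if "u \<in> pverts ?G"
  proof (cases u)
    case (Inl x)
    then have "{w. (u, w) \<in> parcs ?G} = Inr ` {B \<in> \<B>. x \<in> B}" "x \<in> X"
      using that by (auto simp: G)
    then show ?thesis using plane_degree by (simp add: card_image)
  next
    case (Inr B)
    then have B: "B \<in> \<B>" using that by (auto simp: G)
    then have "{w. (u, w) \<in> parcs ?G} = Inl ` B"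
      using Inr plane_block(1) by (auto simp: G)
    then show ?thesis using plane_block(2)[OF B] by (simp add: card_image)
  qed
  show "\<exists>w. (u, w) \<in> parcs ?G \<and> (v, w) \<in> parcs ?G"
    if uv: "u \<in> pverts ?G" "v \<in> pverts ?G" "u \<noteq> v" "isl u = isl v"
  proof (cases u)
    case (Inl x)
    then obtain y where y: "v = Inl y" "x \<in> X" "y \<in> X" "x \<noteq> y"
      using uv by (cases v) (auto simp: G)
    then obtain B where "B \<in> \<B>" "x \<in> B" "y \<in> B" using plane_join by blast
    then show ?thesis using Inl y by (intro exI[of _ "Inr B"]) (auto simp: G)
  next
    case (Inr A)
    then obtain B where B: "v = Inr B" "A \<in> \<B>" "B \<in> \<B>" "A \<noteq> B"
      using uv by (cases v) (auto simp: G)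
    then obtain x where "x \<in> A" "x \<in> B" using plane_meet by blast
    then show ?thesis
      using Inr B plane_block(1) by (intro exI[of _ "Inl x"]) (auto simp: G)
  qed
  \<comment> \<open>\<open>plane_join\<close> settles both cases: two points lie in one block only,
    and two blocks sharing two points coincide.\<close>
  show "w = w'" if "u \<noteq> v" "(u, w) \<in> parcs ?G" "(v, w) \<in> parcs ?G"
      "(u, w') \<in> parcs ?G" "(v, w') \<in> parcs ?G"
    using that plane_join by (cases w; cases w') (auto simp: G)
  show "3 \<le> q + 1" using assms by simp
  show "pverts ?G \<noteq> {}"
    using plane_points by (auto simp: G)
qed

end

text \<open>For \<open>q = 1\<close> the plane is a triangle, and two cops suffice on its incidence
  graph, a 6-cycle; \<open>2 \<le> q\<close> excludes this case.\<close>

theorem theorem23: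
  fixes X :: "'a set" and \<B> :: "'a set set" and q k :: nat
  assumes "projective_plane q X \<B>"
    and "2 \<le> q"
    and "k = q + 1"
  shows "surrounding_cop_number (incidence_graph X \<B>) = k + 1"
  using unique_join_graph.surrounding_cop_number_eq[OF unique_join_incidence_graph[OF assms(1,2)]]
    assms(3) by simp

end
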